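(* Let $A\in\mathbb{R}^{m\times n}$ with $2\le m<n$ be a full-rank matrix with nonzero columns, let $b\in\mathbb{R}^m$, and let $A=U\Sigma V^T$ be a singular value decomposition, where $U\in\mathbb{R}^{m\times m}$ is orthogonal, $\Sigma\in\mathbb{R}^{m\times m}$ is the diagonal matrix of singular values, and $V\in\mathbb{R}^{n\times m}$ has orthonormal columns. (i) If the system $Ax=b$ has a solution $x$ satisfying $\|x\|_0<\left(1+\frac{1}{\mu(V^T)}\right)/2$, then the system has a unique sparsest solution. (ii) Suppose that either $\alpha(V^T)\le\frac{1}{\mu(V^T)}$ and $\beta(V^T)<\alpha(V^T)$, or $\alpha(V^T)<\frac{1}{\mu(V^T)}$. If the system $Ax=b$ has a solution $x$ obeying $$\|x\|_0<\frac12\left(1+\frac{2\left(1-\alpha(V^T)\beta(V^T)\widetilde{\mu}(V^T)^2\right)}{\mu^{(2)}(V^T)\left\{\widetilde{\mu}(V^T)(\alpha(V^T)+\beta(V^T))+\sqrt{\left[\widetilde{\mu}(V^T)(\alpha(V^T)-\beta(V^T))\right]^2+4}\right\}}\right),$$ where $\widetilde{\mu}(V^T):=\mu(V^T)-\mu^{(2)}(V^T)$, then $x$ is the unique sparsest solution to the linear system. In particular, the conclusion is valid if the solution $x$ satisfies $$\|x\|_0<\frac12\left[1+\frac{1}{\mu(V^T)}+\left(\frac{1}{\mu^{(2)}(V^T)}-\frac{1}{\mu(V^T)}\right)(1-\alpha(V^T)\mu(V^T))\right].$$ (iii) If $\mu(V^T)<1$ and $\alpha(V^T)=1$, and if a solution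 $x$ of $Ax=b$ obeys $$\|x\|_0<\frac12\left[1+\frac{1}{\mu(V^T)}+\left(\frac{1}{\mu^{(2)}(V^T)}-\frac{1}{\mu(V^T)}\right)(1-\mu(V^T))\right],$$ then $x$ is the unique sparsest solution of the linear system.
   Context: For a matrix $M\in\mathbb{R}^{m\times n}$ with nonzero columns $c_1,\dots,c_n$, put $g_{ij}=\frac{|c_i^Tc_j|}{\|c_i\|_2\|c_j\|_2}$. The mutual coherence is $\mu(M)=\max_{i\ne j}g_{ij}$. The sub-mutual coherence is $\mu^{(2)}(M)=\max\{g_{ij}: i\ne j,\ g_{ij}<\mu(M)\}$, the second largest distinct value among the $g_{ij}$, $i\neq j$ (convention: $0$ if this set is empty). It is known that $\mu^{(2)}(M)>0$ when $m<n$ and either $\alpha(M)<1/\mu(M)$, or $\alpha(M)\le 1/\mu(M)$ and $\beta(M)<\alpha(M)$. For $i=1,\dots,n$ let $\alpha_i(M)=|\{j: j\ne i,\ g_{ij}=\mu(M)\}|$. The coherence rank is $\alpha(M)=\max_{1\le i\le n}\alpha_i(M)$; let $i_0$ be an index with $\alpha_{i_0}(M)=\alpha(M)$; the sub-coherence rank is $\beta(M)=\max_{i\ne i_0}\alpha_i(M)$ (independent of the choice of $i_0$). $\|x\|_0$ is the number of nonzero components of $x$. A solution $x$ of $Ax=b$ is the unique sparsest solution if $\|x\|_0<\|y\|_0$ for every solution $y\ne x$ of $Ay=b$. *)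

theory Defs
  imports "HOL-Analysis.Analysis"
begin

text \<open>An \<open>m \<times> n\<close> real matrix has type \<open>real ^ 'n ^ 'm\<close> (rows indexed by \<open>'m\<close>, columns by \<open>'n\<close>).
  The coherence notions are meant for matrices with nonzero columns and at least two columns;
  outside that range \<open>x / 0 = 0\<close> and \<open>Max {}\<close> make their values irrelevant.\<close>

definition abs_cos :: "real ^ 'n ^ 'm \<Rightarrow> 'n \<Rightarrow> 'n \<Rightarrow> real" where
  "abs_cos M i j = \<bar>column i M \<bullet> column j M\<bar> / (norm (column i M) * norm (column j M))"

definition mutual_coherence :: "real ^ 'n ^ 'm \<Rightarrow> real" where
  "mutual_coherence M = Max {abs_cos M i j | i j. i \<noteq> j}"

definition sub_mutual_coherence :: "real ^ 'n ^ 'm \<Rightarrow> real" where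
  "sub_mutual_coherence M =
     (let S = {abs_cos M i j | i j. i \<noteq> j \<and> abs_cos M i j < mutual_coherence M}
      in if S = {} then 0 else Max S)"

definition coherence_degree :: "real ^ 'n ^ 'm \<Rightarrow> 'n \<Rightarrow> nat" where
  "coherence_degree M i = card {j. j \<noteq> i \<and> abs_cos M i j = mutual_coherence M}"

definition coherence_rank :: "real ^ 'n ^ 'm \<Rightarrow> nat" where
  "coherence_rank M = Max (range (coherence_degree M))"

definition sub_coherence_rank :: "real ^ 'n ^ 'm \<Rightarrow> nat" where
  "sub_coherence_rank M =
     (let i0 = (SOME i. coherence_degree M i = coherence_rank M)
      in Max (coherence_degree M ` (- {i0})))"

text \<open>The value does not depend on the index picked by \<open>SOME\<close>.\<close>

lemma sub_coherence_rank_eq: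
  assumes "coherence_degree M i0 = coherence_rank M"
  shows "sub_coherence_rank M = Max (coherence_degree M ` (- {i0}))"
proof -
  define i1 where "i1 = (SOME i. coherence_degree M i = coherence_rank M)"
  have i1: "coherence_degree M i1 = coherence_rank M"
    unfolding i1_def by (rule someI[of _ i0]) (rule assms)
  have le: "coherence_degree M i \<le> coherence_rank M" for i
    unfolding coherence_rank_def by (rule Max_ge) auto
  have top: "Max (coherence_degree M ` (- {k})) = coherence_rank M"
    if "coherence_degree M l = coherence_rank M" "l \<noteq> k" for k l
    by (rule Max_eqI) (use that le in auto, metis (no_types) ComplI imageI singletonD)
  have "Max (coherence_degree M ` (- {i1})) = Max (coherence_degree M ` (- {i0}))"
    using top[OF i1, of i0] top[OF assms, of i1] by (cases "i0 = i1") auto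
  then show ?thesis
    by (simp add: sub_coherence_rank_def i1_def)
qed

definition l0_norm :: "real ^ 'n \<Rightarrow> nat" where
  "l0_norm x = card {i. x $ i \<noteq> 0}"

definition unique_sparsest_solution :: "real ^ 'n ^ 'm \<Rightarrow> real ^ 'm \<Rightarrow> real ^ 'n \<Rightarrow> bool" where
  "unique_sparsest_solution A b x \<longleftrightarrow>
     A *v x = b \<and> (\<forall>y. A *v y = b \<and> y \<noteq> x \<longrightarrow> l0_norm x < l0_norm y)"

text \<open>Reduced singular value decomposition \<open>A = U \<Sigma> V\<^sup>T\<close> with square \<open>\<Sigma>\<close>. No order is imposed on
  the singular values, since the index type \<open>'m\<close> carries none.\<close>

definition is_svd ::
  "real ^ 'n ^ 'm \<Rightarrow> real ^ 'm ^ 'm \<Rightarrow> real ^ 'm ^ 'm \<Rightarrow> real ^ 'm ^ 'n \<Rightarrow> bool" where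
  "is_svd A U S V \<longleftrightarrow>
     A = U ** S ** transpose V \<and>
     orthogonal_matrix U \<and>
     (\<forall>i j. i \<noteq> j \<longrightarrow> S $ i $ j = 0) \<and> (\<forall>i. 0 \<le> S $ i $ i) \<and>
     (\<forall>i. norm (column i V) = 1) \<and>
     (\<forall>i j. i \<noteq> j \<longrightarrow> orthogonal (column i V) (column j V))"

end

theory Submission
  imports Defs
begin

text \<open>
  Write \<open>M\<close> for \<open>V\<^sup>T\<close>. Full rank of \<open>A = (U \<Sigma>) M\<close> forces \<open>U \<Sigma>\<close> to be injective, so every null vector of
  \<open>A\<close> is a null vector of \<open>M\<close>. Two distinct solutions differ by such a vector, whose support is at
  most the union of their supports; hence a solution is the unique sparsest one as soon as every
  nonzero null vector of \<open>M\<close> has more than twice as many nonzero entries as it has. All parts of the theorem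
  thus become lower bounds on the support size \<open>k\<close> of a nonzero null vector \<open>z\<close> of \<open>M\<close>.

  Pairing \<open>M z = 0\<close> with a column \<open>c\<^sub>i\<close> shows that the weights \<open>w\<^sub>i = \<bar>z\<^sub>i\<bar> \<parallel>c\<^sub>i\<parallel>\<close> satisfy
  \<open>w\<^sub>i \<le> (\<Sum>j \<noteq> i. g\<^sub>i\<^sub>j w\<^sub>j)\<close>. Comparing the largest and the second largest weight, at \<open>p\<close> and \<open>q\<close> say, yields
  \<open>1 \<le> r\<^sub>p r\<^sub>q\<close> with \<open>r\<^sub>i\<close> the \<open>i\<close>-th off-diagonal row sum of \<open>g\<close> over the support: this is Brauer's
  argument for the ovals of Cassini (lemma \<open>cassini_row_sums\<close>). It remains to estimate row sums. On the one
  hand \<open>r\<^sub>i \<le> (k - 1) \<mu>\<close>, which gives \<open>k \<ge> 1 + 1/\<mu>\<close>. On the other hand at most \<open>\<alpha>\<^sub>i\<close> entries of row \<open>i\<close>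
  equal \<open>\<mu>\<close> and the others are at most \<open>\<mu>\<^sup>(\<^sup>2\<^sup>)\<close>, so with \<open>\<nu> = \<mu> - \<mu>\<^sup>(\<^sup>2\<^sup>)\<close> and \<open>t = (k - 1) \<mu>\<^sup>(\<^sup>2\<^sup>)\<close> one gets
  \<open>r\<^sub>i \<le> t + \<nu> \<alpha>\<^sub>i\<close>. Since \<open>p \<noteq> q\<close>, one of \<open>\<alpha>\<^sub>p\<close>, \<open>\<alpha>\<^sub>q\<close> is at most \<open>\<beta>\<close>, whence
  \<open>1 \<le> (t + \<nu> \<alpha>) (t + \<nu> \<beta>)\<close> (lemma \<open>null_vector_support_bounds\<close>). Solving this quadratic
  inequality for \<open>t\<close> gives the bound with the square root; the simpler bounds express \<open>t + \<nu> \<alpha> < 1\<close>,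
  which makes both factors smaller than \<open>1\<close> because \<open>\<beta> \<le> \<alpha>\<close>. Part (iii) is the instance \<open>\<alpha> = 1\<close>.
\<close>

section \<open>Coherence\<close>

lemma abs_cos_nonneg: "0 \<le> abs_cos M i j"
  by (simp add: abs_cos_def)

lemma finite_abs_cos: "finite {abs_cos M i j | i j. P i j}"
  by (rule finite_subset[of _ "(\<lambda>(i, j). abs_cos M i j) ` UNIV"]) auto

lemma abs_cos_le_mutual_coherence:
  assumes "i \<noteq> j"
  shows "abs_cos M i j \<le> mutual_coherence M"
  unfolding mutual_coherence_def using assms by (intro Max_ge finite_abs_cos) blast

lemma abs_cos_le_sub_mutual_coherence:
  assumes "i \<noteq> j" "abs_cos M i j \<noteq> mutual_coherence M"
  shows "abs_cos M i j \<le> sub_mutual_coherence M"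
proof -
  let ?S = "{abs_cos M i j | i j. i \<noteq> j \<and> abs_cos M i j < mutual_coherence M}"
  have "abs_cos M i j \<in> ?S"
    using assms abs_cos_le_mutual_coherence[of i j M] by fastforce
  then have "abs_cos M i j \<le> Max ?S" and "?S \<noteq> {}"
    by (auto intro!: Max_ge finite_abs_cos simp del: mem_Collect_eq)
  then show ?thesis
    unfolding sub_mutual_coherence_def Let_def by (simp only: if_False)
qed

lemma sub_mutual_coherence_bounds:
  fixes M :: "real ^ 'n ^ 'm" and i j :: 'n
  assumes "i \<noteq> j"
  shows "0 \<le> sub_mutual_coherence M" "sub_mutual_coherence M \<le> mutual_coherence M"
proof -
  let ?S = "{abs_cos M i j | i j. i \<noteq> j \<and> abs_cos M i j < mutual_coherence M}"
  have "0 \<le> mutual_coherence M"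
    using abs_cos_le_mutual_coherence[OF assms] abs_cos_nonneg order_trans by blast
  moreover have "0 \<le> r \<and> r \<le> mutual_coherence M" if "r \<in> ?S" for r
    using that by (auto simp: abs_cos_nonneg)
  then have "0 \<le> Max ?S \<and> Max ?S \<le> mutual_coherence M" if "?S \<noteq> {}"
    using Max_in[OF finite_abs_cos that] by blast
  ultimately show "0 \<le> sub_mutual_coherence M" "sub_mutual_coherence M \<le> mutual_coherence M"
    unfolding sub_mutual_coherence_def Let_def by (cases "?S = {}"; simp only: if_True if_False)+
qed

lemma coherence_degree_le_rank: "coherence_degree M i \<le> coherence_rank M"
  unfolding coherence_rank_def by (rule Max_ge) auto

lemma coherence_rank_attained:
  obtains i0 where "coherence_degree M i0 = coherence_rank M"
proof -
  have "coherence_rank M \<in> range (coherence_degree M)"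
    unfolding coherence_rank_def by (rule Max_in) auto
  then show ?thesis using that by auto
qed

text \<open>Of two distinct indices, at least one differs from an index of maximal degree and therefore
  falls under the sub-coherence rank.\<close>

lemma coherence_degree_pair:
  assumes "p \<noteq> q"
  shows "coherence_degree M p \<le> coherence_rank M \<and> coherence_degree M q \<le> sub_coherence_rank M \<or>
         coherence_degree M q \<le> coherence_rank M \<and> coherence_degree M p \<le> sub_coherence_rank M"
proof -
  obtain i0 where i0: "coherence_degree M i0 = coherence_rank M"
    by (rule coherence_rank_attained)
  have "coherence_degree M i \<le> sub_coherence_rank M" if "i \<noteq> i0" for i
    unfolding sub_coherence_rank_eq[OF i0] using that by (intro Max_ge) auto
  then show ?thesis
    using assms coherence_degree_le_rank by metis
qed

lemma sub_coherence_rank_le: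
  fixes M :: "real ^ 'n ^ 'm"
  assumes "(p :: 'n) \<noteq> q"
  shows "sub_coherence_rank M \<le> coherence_rank M"
proof -
  obtain i0 where i0: "coherence_degree M i0 = coherence_rank M"
    by (rule coherence_rank_attained)
  have "p \<in> - {i0} \<or> q \<in> - {i0}"
    using assms by auto
  then have "- {i0} \<noteq> {}" by blast
  then show ?thesis
    unfolding sub_coherence_rank_eq[OF i0] using coherence_degree_le_rank[of M]
    by (intro Max.boundedI) auto
qed

text \<open>Every entry of a row is at most \<open>\<mu>\<^sup>(\<^sup>2\<^sup>)\<close>, except for the entries equal to \<open>\<mu>\<close>, each of which exceeds
  it by \<open>\<mu> - \<mu>\<^sup>(\<^sup>2\<^sup>)\<close>; the coherence degree counts the exceptions.\<close>

lemma abs_cos_row_sum_le: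
  fixes M :: "real ^ 'n ^ 'm"
  assumes "i \<in> T"
  shows "(\<Sum>j\<in>T - {i}. abs_cos M i j) \<le> (real (card T) - 1) * sub_mutual_coherence M
           + (mutual_coherence M - sub_mutual_coherence M) * real (coherence_degree M i)"
proof (cases "T = {i}")
  case True
  have "(mutual_coherence M - sub_mutual_coherence M) * real (coherence_degree M i) \<ge> 0"
  proof (cases "coherence_degree M i = 0")
    case False
    then obtain j where "j \<noteq> i"
      unfolding coherence_degree_def by (metis (mono_tags, lifting) card.empty empty_Collect_eq)
    then show ?thesis
      using sub_mutual_coherence_bounds by (intro mult_nonneg_nonneg) auto
  qed simp
  then show ?thesis using True by simp
next
  case False
  define \<mu> where "\<mu> = mutual_coherence M"
  define \<mu>2 where "\<mu>2 = sub_mutual_coherence M"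
  define D where "D = {j. j \<noteq> i \<and> abs_cos M i j = \<mu>}"
  obtain j where "j \<noteq> i" using False assms by blast
  then have le: "\<mu>2 \<le> \<mu>"
    unfolding \<mu>_def \<mu>2_def by (rule sub_mutual_coherence_bounds)
  have "(\<Sum>j\<in>T - {i}. abs_cos M i j) \<le> (\<Sum>j\<in>T - {i}. \<mu>2 + (if j \<in> D then \<mu> - \<mu>2 else 0))"
    by (rule sum_mono)
       (auto simp: D_def \<mu>_def \<mu>2_def intro: abs_cos_le_sub_mutual_coherence)
  also have "\<dots> = (real (card T) - 1) * \<mu>2 + real (card ((T - {i}) \<inter> D)) * (\<mu> - \<mu>2)"
    using assms card_gt_0_iff[of T] by (auto simp: sum.distrib sum.If_cases of_nat_diff)
  also have "\<dots> \<le> (real (card T) - 1) * \<mu>2 + real (card D) * (\<mu> - \<mu>2)"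
    using le by (intro add_left_mono mult_right_mono of_nat_mono card_mono) auto
  finally show ?thesis
    by (simp add: \<mu>_def \<mu>2_def D_def coherence_degree_def mult.commute)
qed

section \<open>Supports of null vectors\<close>

text \<open>The row inequality at the largest weight \<open>w p\<close>, where the other weights are at most the second
  largest one \<open>w q\<close>, reads \<open>w p \<le> r p * w q\<close>; the row inequality at \<open>q\<close> reads \<open>w q \<le> r q * w p\<close>.
  Multiplying the two cancels the weights.\<close>

lemma cassini_row_sums:
  fixes w :: "'a \<Rightarrow> real"
  assumes "finite T" "T \<noteq> {}"
    and w: "\<And>i. i \<in> T \<Longrightarrow> 0 < w i"
    and g: "\<And>i j. 0 \<le> g i j"
    and row: "\<And>i. i \<in> T \<Longrightarrow> w i \<le> (\<Sum>j\<in>T - {i}. g i j * w j)"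
  obtains p q where "p \<in> T" "q \<in> T" "p \<noteq> q"
    "1 \<le> (\<Sum>j\<in>T - {p}. g p j) * (\<Sum>j\<in>T - {q}. g q j)"
proof -
  let ?r = "\<lambda>i. \<Sum>j\<in>T - {i}. g i j"
  have maximizer: "\<exists>p\<in>S. \<forall>i\<in>S. w i \<le> w p" if "finite S" "S \<noteq> {}" for S
  proof -
    have "Max (w ` S) \<in> w ` S" using that by simp
    then obtain p where "p \<in> S" "w p = Max (w ` S)" by auto
    then show ?thesis using that by (intro bexI[of _ p]) auto
  qed
  obtain p where p: "p \<in> T" "\<And>i. i \<in> T \<Longrightarrow> w i \<le> w p"
    using maximizer[OF assms(1,2)] by blast
  have "T - {p} \<noteq> {}"
    using row[OF p(1)] w[OF p(1)] by (metis leD sum.empty)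
  from maximizer[OF finite_Diff[OF assms(1)] this]
  obtain q where q: "q \<in> T - {p}" "\<And>i. i \<in> T - {p} \<Longrightarrow> w i \<le> w q"
    by blast
  have "w p \<le> (\<Sum>j\<in>T - {p}. g p j * w q)"
    by (rule order_trans[OF row[OF p(1)]]) (intro sum_mono mult_left_mono q g)
  then have wp: "w p \<le> ?r p * w q" by (simp add: sum_distrib_right)
  have "w q \<le> (\<Sum>j\<in>T - {q}. g q j * w p)"
    by (rule order_trans[OF row]) (use q p g in \<open>auto intro!: sum_mono mult_left_mono\<close>)
  then have wq: "w q \<le> ?r q * w p" by (simp add: sum_distrib_right)
  have "w p \<le> ?r p * (?r q * w p)"
    using wp mult_left_mono[OF wq, of "?r p"] by (simp add: sum_nonneg g)
  then have "1 * w p \<le> (?r p * ?r q) * w p" by (simp add: mult.assoc)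
  then have "1 \<le> ?r p * ?r q"
    using w[OF p(1)] by (simp only: mult_le_cancel_right_pos)
  then show ?thesis using that p(1) q(1) by blast
qed

text \<open>The inner product of the relation \<open>M z = 0\<close> with a column expresses the diagonal term through
  the off-diagonal ones; scaling by the column norms turns the inner products into cosines.\<close>

lemma null_vector_row_inequality:
  fixes M :: "real ^ 'n ^ 'm"
  assumes col: "\<And>j. column j M \<noteq> 0" and z: "M *v z = 0"
  shows "\<bar>z $ i\<bar> * norm (column i M)
    \<le> (\<Sum>j\<in>{j. z $ j \<noteq> 0} - {i}. abs_cos M i j * (\<bar>z $ j\<bar> * norm (column j M)))"
proof -
  let ?c = "\<lambda>j. column j M" and ?T = "{j. z $ j \<noteq> 0}"
  have "0 = ?c i \<bullet> (M *v z)" by (simp add: z)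
  also have "\<dots> = (\<Sum>j\<in>UNIV. z $ j * (?c i \<bullet> ?c j))"
    by (simp add: matrix_mult_sum inner_sum_right scalar_mult_eq_scaleR)
  also have "\<dots> = z $ i * (?c i \<bullet> ?c i) + (\<Sum>j\<in>UNIV - {i}. z $ j * (?c i \<bullet> ?c j))"
    by (rule sum.remove) auto
  also have "(\<Sum>j\<in>UNIV - {i}. z $ j * (?c i \<bullet> ?c j)) = (\<Sum>j\<in>?T - {i}. z $ j * (?c i \<bullet> ?c j))"
    by (rule sum.mono_neutral_right) auto
  finally have "\<bar>z $ i * (?c i \<bullet> ?c i)\<bar> = \<bar>\<Sum>j\<in>?T - {i}. z $ j * (?c i \<bullet> ?c j)\<bar>"
    by linarith
  also have "\<dots> \<le> (\<Sum>j\<in>?T - {i}. \<bar>z $ j * (?c i \<bullet> ?c j)\<bar>)" by (rule sum_abs)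
  also have "\<dots> = (\<Sum>j\<in>?T - {i}. abs_cos M i j * (\<bar>z $ j\<bar> * norm (?c j))) * norm (?c i)"
    unfolding sum_distrib_right
    by (rule sum.cong) (use col in \<open>auto simp: abs_cos_def abs_mult field_simps\<close>)
  finally have "(\<bar>z $ i\<bar> * norm (?c i)) * norm (?c i)
      \<le> (\<Sum>j\<in>?T - {i}. abs_cos M i j * (\<bar>z $ j\<bar> * norm (?c j))) * norm (?c i)"
    by (simp add: abs_mult dot_square_norm power2_eq_square mult.assoc)
  then show ?thesis using col[of i] by (simp add: mult_le_cancel_right)
qed

text \<open>Both bounds come from \<open>cassini_row_sums\<close>: in the first one all off-diagonal cosines are replaced by
  \<open>\<mu>\<close>; in the second one \<open>t\<close> is the row sum that would arise if they all were at most \<open>\<mu>2\<close>, and \<open>\<alpha>\<close>,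
  \<open>\<beta>\<close> account for the entries equal to \<open>\<mu>\<close>.\<close>

lemma null_vector_support_bounds:
  fixes M :: "real ^ 'n ^ 'm"
  defines "\<mu> \<equiv> mutual_coherence M" and "\<mu>2 \<equiv> sub_mutual_coherence M"
    and "\<alpha> \<equiv> real (coherence_rank M)" and "\<beta> \<equiv> real (sub_coherence_rank M)"
  assumes col: "\<And>j. column j M \<noteq> 0" and z: "M *v z = 0" "z \<noteq> 0"
  defines "t \<equiv> (real (l0_norm z) - 1) * \<mu>2"
  shows "1 \<le> (real (l0_norm z) - 1) * \<mu>"
    and "1 \<le> (t + (\<mu> - \<mu>2) * \<alpha>) * (t + (\<mu> - \<mu>2) * \<beta>)"
    and "0 \<le> \<mu>2" and "\<mu>2 \<le> \<mu>" and "0 \<le> t" and "\<beta> \<le> \<alpha>"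
proof -
  define T where "T = {j. z $ j \<noteq> 0}"
  define k where "k = real (card T)"
  have k: "real (l0_norm z) = k" by (simp add: l0_norm_def T_def k_def)
  have ne: "T \<noteq> {}" using z(2) by (auto simp: T_def vec_eq_iff)
  obtain p q where pq: "p \<in> T" "q \<in> T" "p \<noteq> q"
    and prod: "1 \<le> (\<Sum>j\<in>T - {p}. abs_cos M p j) * (\<Sum>j\<in>T - {q}. abs_cos M q j)"
    by (rule cassini_row_sums[of T "\<lambda>i. \<bar>z $ i\<bar> * norm (column i M)" "abs_cos M"])
       (use ne null_vector_row_inequality[OF col z(1)] col abs_cos_nonneg in \<open>auto simp: T_def\<close>)
  show \<mu>2: "0 \<le> \<mu>2" "\<mu>2 \<le> \<mu>"
    unfolding \<mu>_def \<mu>2_def using sub_mutual_coherence_bounds[OF pq(3)] by auto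
  show \<beta>\<alpha>: "\<beta> \<le> \<alpha>"
    unfolding \<alpha>_def \<beta>_def using sub_coherence_rank_le[OF pq(3)] by simp
  have k1: "1 \<le> k"
    using pq card_gt_0_iff[of T] by (auto simp: k_def Suc_le_eq)
  with \<mu>2(1) show t: "0 \<le> t" by (simp add: t_def k)
  have row_nonneg: "0 \<le> (\<Sum>j\<in>T - {i}. abs_cos M i j)" for i
    by (intro sum_nonneg abs_cos_nonneg)
  show "1 \<le> (real (l0_norm z) - 1) * \<mu>"
  proof (rule ccontr)
    assume "\<not> 1 \<le> (real (l0_norm z) - 1) * \<mu>"
    moreover have "(\<Sum>j\<in>T - {i}. abs_cos M i j) \<le> (k - 1) * \<mu>" if "i \<in> T" for i
    proof -
      have "(\<Sum>j\<in>T - {i}. abs_cos M i j) \<le> real (card (T - {i})) * \<mu>"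
        by (rule sum_bounded_above) (auto simp: \<mu>_def intro: abs_cos_le_mutual_coherence)
      then show ?thesis using that k1 by (simp add: k_def of_nat_diff)
    qed
    ultimately have "(\<Sum>j\<in>T - {p}. abs_cos M p j) < 1" "(\<Sum>j\<in>T - {q}. abs_cos M q j) < 1"
      using pq unfolding k by fastforce+
    then show False
      using prod mult_strict_mono[of _ 1 _ 1] row_nonneg[of q] by fastforce
  qed
  let ?b = "\<lambda>d. t + (\<mu> - \<mu>2) * d"
  have row: "(\<Sum>j\<in>T - {i}. abs_cos M i j) \<le> ?b d" if "i \<in> T" "real (coherence_degree M i) \<le> d" for i d
  proof -
    have "(\<Sum>j\<in>T - {i}. abs_cos M i j) \<le> ?b (real (coherence_degree M i))"
      using abs_cos_row_sum_le[OF that(1), of M] by (simp add: t_def \<mu>_def \<mu>2_def l0_norm_def T_def)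
    also have "\<dots> \<le> ?b d"
      using that(2) \<mu>2 by (intro add_left_mono mult_left_mono) auto
    finally show ?thesis .
  qed
  have b_nonneg: "0 \<le> ?b (real d)" for d :: nat
    using t \<mu>2 by simp
  note mono = mult_mono[OF row row]
  from coherence_degree_pair[OF pq(3), of M] show "1 \<le> ?b \<alpha> * ?b \<beta>"
  proof
    assume "coherence_degree M p \<le> coherence_rank M \<and> coherence_degree M q \<le> sub_coherence_rank M"
    then have "(\<Sum>j\<in>T - {p}. abs_cos M p j) * (\<Sum>j\<in>T - {q}. abs_cos M q j) \<le> ?b \<alpha> * ?b \<beta>"
      unfolding \<alpha>_def \<beta>_def using pq row_nonneg b_nonneg by (intro mono) auto
    then show ?thesis using prod by linarith
  next
    assume "coherence_degree M q \<le> coherence_rank M \<and> coherence_degree M p \<le> sub_coherence_rank M"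
    then have "(\<Sum>j\<in>T - {p}. abs_cos M p j) * (\<Sum>j\<in>T - {q}. abs_cos M q j) \<le> ?b \<beta> * ?b \<alpha>"
      unfolding \<alpha>_def \<beta>_def using pq row_nonneg b_nonneg by (intro mono) auto
    then show ?thesis using prod by (simp add: mult.commute)
  qed
qed

section \<open>Solving the quadratic inequality\<close>

text \<open>The right-hand side is the larger root \<open>(sqrt ((\<nu> (\<alpha> - \<beta>))\<^sup>2 + 4) - \<nu> (\<alpha> + \<beta>)) / 2\<close> of the
  quadratic polynomial \<open>(t + \<nu> \<alpha>) (t + \<nu> \<beta>) - 1\<close>, with rationalized numerator. The smaller root is negative,
  so a nonnegative \<open>t\<close> at which the polynomial is nonnegative lies beyond the larger one.\<close>

lemma cassini_root_le:
  fixes t \<nu> \<alpha> \<beta> :: real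
  assumes "0 \<le> t" "0 \<le> \<nu>" "0 \<le> \<alpha>" "0 \<le> \<beta>" and prod: "1 \<le> (t + \<nu> * \<alpha>) * (t + \<nu> * \<beta>)"
  shows "2 * (1 - \<alpha> * \<beta> * \<nu>\<^sup>2) / (\<nu> * (\<alpha> + \<beta>) + sqrt ((\<nu> * (\<alpha> - \<beta>))\<^sup>2 + 4)) \<le> t"
proof -
  define R where "R = sqrt ((\<nu> * (\<alpha> - \<beta>))\<^sup>2 + 4)"
  define s where "s = \<nu> * (\<alpha> + \<beta>)"
  have R2: "R\<^sup>2 = (\<nu> * (\<alpha> - \<beta>))\<^sup>2 + 4"
    unfolding R_def by (rule real_sqrt_pow2) (simp add: add_nonneg_nonneg)
  have R: "0 < R" unfolding R_def by (simp add: add_nonneg_pos)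
  have s: "0 \<le> s" using assms by (simp add: s_def)
  have "R\<^sup>2 \<le> (2 * t + s)\<^sup>2"
    using prod unfolding R2 s_def by (simp add: power2_eq_square algebra_simps)
  then have root: "R \<le> 2 * t + s"
    by (rule power2_le_imp_le) (use assms s in simp)
  have "4 * (1 - \<alpha> * \<beta> * \<nu>\<^sup>2) = (R - s) * (R + s)"
    using R2 unfolding s_def by (simp add: power2_eq_square algebra_simps)
  then have "2 * (1 - \<alpha> * \<beta> * \<nu>\<^sup>2) / (s + R) = (R - s) / 2"
    using R s by (simp add: field_simps)
  also have "\<dots> \<le> t" using root by simp
  finally show ?thesis by (simp only: s_def R_def)
qed

section \<open>Sparsest solutions\<close>

text \<open>If \<open>y\<close> is another solution with at most as many nonzero entries as \<open>x\<close>, then \<open>x - y\<close> is a null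
  vector supported on the union of the two supports.\<close>

lemma unique_sparsest_solutionI:
  assumes x: "A *v x = b"
    and null: "\<And>z. A *v z = 0 \<Longrightarrow> z \<noteq> 0 \<Longrightarrow> l0_norm z \<le> 2 * l0_norm x \<Longrightarrow> False"
  shows "unique_sparsest_solution A b x"
  unfolding unique_sparsest_solution_def
proof (intro conjI allI impI)
  show "A *v x = b" by (rule x)
  fix y assume y: "A *v y = b \<and> y \<noteq> x"
  show "l0_norm x < l0_norm y"
  proof (rule ccontr)
    assume le: "\<not> l0_norm x < l0_norm y"
    have "l0_norm (x - y) \<le> card ({i. x $ i \<noteq> 0} \<union> {i. y $ i \<noteq> 0})"
      unfolding l0_norm_def by (rule card_mono) auto
    also have "\<dots> \<le> l0_norm x + l0_norm y"
      unfolding l0_norm_def by (rule card_Un_le)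
    finally have "l0_norm (x - y) \<le> 2 * l0_norm x" using le by linarith
    then show False
      using null[of "x - y"] x y by (auto simp: matrix_vector_mult_diff_distrib)
  qed
qed

text \<open>The rank of a product is at most that of its left factor, so the square factor has full rank.\<close>

lemma full_row_rank_factor_injective:
  fixes B :: "real ^ 'm ^ 'm" and M :: "real ^ 'n ^ 'm"
  assumes "rank (B ** M) = CARD('m)"
  shows "inj ((*v) B)"
proof -
  have "rank B = CARD('m)"
    using rank_mul_le_left[of B M] rank_bound[of B] assms by simp
  then show ?thesis by (simp add: full_rank_injective)
qed

theorem corollary4p9:
  fixes A :: "real ^ 'n ^ 'm" and b :: "real ^ 'm"
    and U S :: "real ^ 'm ^ 'm" and V :: "real ^ 'm ^ 'n"
  assumes "2 \<le> CARD('m)" and "CARD('m) < CARD('n)"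
    and "rank A = min CARD('m) CARD('n)"
    and "\<And>j. column j A \<noteq> 0"
    and "is_svd A U S V"
  shows
    "let \<mu> = mutual_coherence (transpose V);
         \<mu>2 = sub_mutual_coherence (transpose V);
         \<alpha> = real (coherence_rank (transpose V));
         \<beta> = real (sub_coherence_rank (transpose V));
         \<nu> = \<mu> - \<mu>2
     in
       ((\<exists>x. A *v x = b \<and> real (l0_norm x) < (1 + 1 / \<mu>) / 2)
          \<longrightarrow> (\<exists>x. unique_sparsest_solution A b x)) \<and>
       ((\<alpha> \<le> 1 / \<mu> \<and> \<beta> < \<alpha>) \<or> \<alpha> < 1 / \<mu>
          \<longrightarrow>
          (\<forall>x. A *v x = b \<and>
               real (l0_norm x) <
                 1 / 2 * (1 + 2 * (1 - \<alpha> * \<beta> * \<nu>\<^sup>2) /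
                   (\<mu>2 * (\<nu> * (\<alpha> + \<beta>) + sqrt ((\<nu> * (\<alpha> - \<beta>))\<^sup>2 + 4))))
             \<longrightarrow> unique_sparsest_solution A b x) \<and>
          (\<forall>x. A *v x = b \<and>
               real (l0_norm x) <
                 1 / 2 * (1 + 1 / \<mu> + (1 / \<mu>2 - 1 / \<mu>) * (1 - \<alpha> * \<mu>))
             \<longrightarrow> unique_sparsest_solution A b x)) \<and>
       (\<mu> < 1 \<and> \<alpha> = 1
          \<longrightarrow>
          (\<forall>x. A *v x = b \<and>
               real (l0_norm x) <
                 1 / 2 * (1 + 1 / \<mu> + (1 / \<mu>2 - 1 / \<mu>) * (1 - \<mu>))
             \<longrightarrow> unique_sparsest_solution A b x))"
proof -
  define M where "M = transpose V"
  define \<mu> where "\<mu> = mutual_coherence M"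
  define \<mu>2 where "\<mu>2 = sub_mutual_coherence M"
  define \<alpha> where "\<alpha> = real (coherence_rank M)"
  define \<beta> where "\<beta> = real (sub_coherence_rank M)"
  define \<nu> where "\<nu> = \<mu> - \<mu>2"
  have A: "A = (U ** S) ** M" using assms(5) by (simp add: is_svd_def M_def)
  have inj: "inj ((*v) (U ** S))"
    using full_row_rank_factor_injective[of "U ** S" M] assms(2,3) A by simp
  have null_M: "M *v z = 0" if "A *v z = 0" for z
    using that injD[OF inj, of "M *v z" 0] by (simp add: A matrix_vector_mul_assoc)
  have col: "column j M \<noteq> 0" for j
  proof
    assume "column j M = 0"
    then have "(U ** S) *v (M *v axis j 1) = 0"
      by (simp only: matrix_vector_mult_basis matrix_vector_mult_0_right)
    moreover have "(U ** S) *v (M *v axis j 1) = column j A"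
      by (simp only: A matrix_vector_mul_assoc flip: matrix_vector_mult_basis)
    ultimately show False using assms(4) by simp
  qed
  note bounds = null_vector_support_bounds[OF col null_M,
      folded \<mu>_def \<mu>2_def \<alpha>_def \<beta>_def, folded \<nu>_def]
  have \<alpha>\<beta>_nonneg: "0 \<le> \<alpha>" "0 \<le> \<beta>" by (simp_all add: \<alpha>_def \<beta>_def)

  have coherence_bound: "unique_sparsest_solution A b x"
    if "A *v x = b" "real (l0_norm x) < (1 + 1 / \<mu>) / 2" for x
  proof (rule unique_sparsest_solutionI[OF that(1)])
    fix z assume z: "A *v z = 0" "z \<noteq> 0" "l0_norm z \<le> 2 * l0_norm x"
    have "0 < \<mu>" using bounds(1,3,4)[OF z(1,2)] by (cases "\<mu> = 0") auto
    then have "1 / \<mu> \<le> real (l0_norm z) - 1"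
      using bounds(1)[OF z(1,2)] by (simp add: field_simps)
    moreover have "2 * real (l0_norm x) < 1 + 1 / \<mu>" using that(2) by simp
    ultimately show False using z(3) by linarith
  qed

  have cassini_bound: "unique_sparsest_solution A b x"
    if "A *v x = b" "real (l0_norm x) < 1 / 2 * (1 + 2 * (1 - \<alpha> * \<beta> * \<nu>\<^sup>2) /
          (\<mu>2 * (\<nu> * (\<alpha> + \<beta>) + sqrt ((\<nu> * (\<alpha> - \<beta>))\<^sup>2 + 4))))" for x
  proof (rule unique_sparsest_solutionI[OF that(1)])
    fix z assume z: "A *v z = 0" "z \<noteq> 0" "l0_norm z \<le> 2 * l0_norm x"
    note bd = bounds[OF z(1,2)]
    let ?k = "real (l0_norm z)"
      and ?Q = "2 * (1 - \<alpha> * \<beta> * \<nu>\<^sup>2) / (\<nu> * (\<alpha> + \<beta>) + sqrt ((\<nu> * (\<alpha> - \<beta>))\<^sup>2 + 4))"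
    have k: "?k < 1 + ?Q / \<mu>2"
      using that(2) z(3) by (simp add: mult.commute)
    have "1 < ?k"
      using bd(1) mult_nonpos_nonneg[of "?k - 1" \<mu>] bd(3,4) by linarith
    \<comment> \<open>Division by \<open>\<mu>2 = 0\<close> yields \<open>0\<close>, and then the bound on \<open>?k\<close> is absurd.\<close>
    then have "0 < \<mu>2" using k bd(3) by (cases "\<mu>2 = 0") auto
    moreover have "?Q \<le> (?k - 1) * \<mu>2"
      using bd \<alpha>\<beta>_nonneg by (intro cassini_root_le) (auto simp: \<nu>_def)
    ultimately have "?Q / \<mu>2 \<le> ?k - 1" by (simp only: pos_divide_le_eq)
    then show False using k by linarith
  qed

  have rank_bound: "unique_sparsest_solution A b x"
    if rank: "0 < \<mu> \<Longrightarrow> (\<alpha> \<le> 1 / \<mu> \<and> \<beta> < \<alpha>) \<or> \<alpha> < 1 / \<mu>" and "A *v x = b"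
      "real (l0_norm x) < 1 / 2 * (1 + 1 / \<mu> + (1 / \<mu>2 - 1 / \<mu>) * (1 - \<alpha> * \<mu>))" for x
  proof (rule unique_sparsest_solutionI[OF that(2)])
    fix z assume z: "A *v z = 0" "z \<noteq> 0" "l0_norm z \<le> 2 * l0_norm x"
    note bd = bounds[OF z(1,2)]
    let ?k = "real (l0_norm z)"
    have \<mu>: "0 < \<mu>" using bd(1,3,4) by (cases "\<mu> = 0") auto
    \<comment> \<open>The two rank conditions serve to exclude \<open>\<mu>2 = 0\<close>, where the Cassini inequality reads
      \<open>1 \<le> (\<mu> \<alpha>) (\<mu> \<beta>)\<close>.\<close>
    have "\<mu>2 \<noteq> 0"
    proof
      assume "\<mu>2 = 0"
      then have "1 \<le> (\<mu> * \<alpha>) * (\<mu> * \<beta>)" using bd(2) by (simp add: \<nu>_def)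
      moreover have "\<alpha> \<le> 1 / \<mu>" "\<beta> < 1 / \<mu>"
        using rank[OF \<mu>] bd(6) by linarith+
      then have "\<mu> * \<alpha> \<le> 1" "\<mu> * \<beta> < 1"
        using \<mu> by (simp_all add: pos_le_divide_eq pos_less_divide_eq mult.commute)
      moreover have "(\<mu> * \<alpha>) * (\<mu> * \<beta>) \<le> 1 * (\<mu> * \<beta>)"
        using \<open>\<mu> * \<alpha> \<le> 1\<close> \<mu> \<alpha>\<beta>_nonneg by (intro mult_right_mono) auto
      ultimately show False using \<open>\<mu> * \<beta> < 1\<close> by linarith
    qed
    then have \<mu>2: "0 < \<mu>2" using bd(3) by linarith
    define B where "B = 1 / \<mu> + (1 / \<mu>2 - 1 / \<mu>) * (1 - \<alpha> * \<mu>)"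
    have "real (l0_norm x) < 1 / 2 * (1 + B)"
      using that(3) by (simp only: B_def add.assoc)
    then have "?k - 1 < B"
      using z(3) by simp
    also have "B = (1 - \<nu> * \<alpha>) / \<mu>2"
      using \<mu> \<mu>2 by (simp add: B_def \<nu>_def field_simps)
    finally have "(?k - 1) * \<mu>2 + \<nu> * \<alpha> < 1"
      using \<mu>2 by (simp add: field_simps)
    moreover have "\<nu> * \<beta> \<le> \<nu> * \<alpha>" "0 \<le> \<nu> * \<beta>"
      using bd(4,6) \<alpha>\<beta>_nonneg by (auto simp: \<nu>_def intro: mult_left_mono)
    ultimately have "((?k - 1) * \<mu>2 + \<nu> * \<alpha>) * ((?k - 1) * \<mu>2 + \<nu> * \<beta>) < 1 * 1"
      using bd(5) by (intro mult_strict_mono) auto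
    then show False using bd(2) by simp
  qed

  show ?thesis
    unfolding Let_def M_def[symmetric]
    unfolding \<mu>_def[symmetric] \<mu>2_def[symmetric] \<alpha>_def[symmetric] \<beta>_def[symmetric]
    unfolding \<nu>_def[symmetric]
  proof (intro conjI impI allI)
    assume "\<exists>x. A *v x = b \<and> real (l0_norm x) < (1 + 1 / \<mu>) / 2"
    then show "\<exists>x. unique_sparsest_solution A b x" using coherence_bound by blast
  next
    fix x
    assume "A *v x = b \<and> real (l0_norm x) < 1 / 2 * (1 + 2 * (1 - \<alpha> * \<beta> * \<nu>\<^sup>2) /
          (\<mu>2 * (\<nu> * (\<alpha> + \<beta>) + sqrt ((\<nu> * (\<alpha> - \<beta>))\<^sup>2 + 4))))"
    then show "unique_sparsest_solution A b x" using cassini_bound by blast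
  next
    fix x
    assume "\<alpha> \<le> 1 / \<mu> \<and> \<beta> < \<alpha> \<or> \<alpha> < 1 / \<mu>"
      and "A *v x = b \<and>
        real (l0_norm x) < 1 / 2 * (1 + 1 / \<mu> + (1 / \<mu>2 - 1 / \<mu>) * (1 - \<alpha> * \<mu>))"
    then show "unique_sparsest_solution A b x" using rank_bound by blast
  next
    fix x
    assume \<mu>\<alpha>: "\<mu> < 1 \<and> \<alpha> = 1"
      and x: "A *v x = b \<and>
        real (l0_norm x) < 1 / 2 * (1 + 1 / \<mu> + (1 / \<mu>2 - 1 / \<mu>) * (1 - \<mu>))"
    have "\<alpha> < 1 / \<mu>" if "0 < \<mu>" using \<mu>\<alpha> that by simp
    then show "unique_sparsest_solution A b x" using rank_bound[of x] x \<mu>\<alpha> by simp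
  qed
qed

end
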